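(* Let $\{x_t\},\{\widetilde x_t\},\{\bar x_t\},\{y_t\}$ be generated by the AC-APDHG iteration (defined in the context) with parameters $\eta_t>0$, $\tau_t\ge0$, $\widetilde\tau_t\ge0$, $\mu_d>0$, $\beta\in(0,1)$ satisfying $$\tau_1=0,\quad\widetilde\tau_1=0,\quad\beta_1=0,\quad\beta_t=\beta>0\ (t\ge2),\qquad\eta_2\le\min\Big\{(1-\beta)\eta_1,\ \Big(\frac{4L_{A,1}^2}{\mu_d}+4L_{f,1}\Big)^{-1}\Big\},$$ $$\eta_t\le\min\Big\{2(1-\beta)^2\eta_{t-1},\ \frac{\widetilde\tau_{t-2}+1}{\widetilde\tau_{t-1}}\eta_{t-1},\ \frac{\tau_{t-2}+\mu_d}{\tau_{t-1}}\eta_{t-1},\ \Big(\frac{4L_{A,t-1}^2}{\tau_{t-1}}+\frac{4L_{f,t-1}}{\widetilde\tau_{t-1}}\Big)^{-1}\Big\},\quad t\ge3.$$ Then for every $z=(x,y)\in Z$ and every $k\ge2$, $$Q(\widehat z_k,z)-\frac{\mu_d}{2}\|\widetilde y_0-y\|^2+\frac{\mu_d}{2}\|\widetilde y_0-\widehat y_k\|^2+\frac{\mu_d}{2}\|\widetilde y_k-y\|^2$$ $$\le\frac1{\sum_{t=1}^k\eta_{t+1}}\Big[\frac{\|x_0-x\|^2}{2\beta}+\Big(\frac{5\eta_2L_{A,1}^2}{4\mu_d}+\frac{5\eta_2L_{f,1}}{4}-\frac{\eta_2}{2\eta_1}\Big)\|x_1-x_0\|^2-\frac{\|x_{k+1}-\bar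 x_k\|^2}{4}-\frac{\|\bar x_{k+1}-x\|^2}{2\beta}\Big],$$ where $$\widehat x_k=\frac{\sum_{t=1}^k\eta_{t+1}x_t}{\sum_{t=1}^k\eta_{t+1}},\quad \widehat y_k=\frac{\sum_{t=1}^k\eta_{t+1}y_t}{\sum_{t=1}^k\eta_{t+1}},\quad \widehat z_k=(\widehat x_k,\widehat y_k),$$ $$\widetilde y_k=\frac{\sum_{t=1}^{k-1}\big(\eta_{t+1}(\mu_d+\tau_t)-\eta_{t+2}\tau_{t+1}\big)y_t+\eta_{k+1}(\mu_d+\tau_k)y_k}{\mu_d\sum_{t=1}^k\eta_{t+1}}.$$
   Context: Setting: $X\subseteq\mathbb{R}^n$ and $Y\subseteq\mathbb{R}^m$ are nonempty closed convex sets, $Z=X\times Y$, $A\in\mathbb{R}^{m\times n}$, $g:Y\to\mathbb{R}$ is proper, lower semicontinuous, convex, and $f:X\to\mathbb{R}$ is a differentiable convex function satisfying, for some $L_f>0$ and all $x,y\in X$, $\frac1{2L_f}\|\nabla f(x)-\nabla f(y)\|^2\le f(y)-f(x)-\langle\nabla f(x),y-x\rangle\le\frac{L_f}{2}\|x-y\|^2$. Norms are Euclidean. The problem $\min_{x\in X}\max_{y\in Y}f(x)+\langle Ax,y\rangle-g(y)$ is assumed to have a saddle point. For $\bar z=(\bar x,\bar y)\in Z$ and $z=(x,y)\in Z$, $Q(\bar z,z)=f(\bar x)+\langle A\bar x,y\rangle-g(y)-[f(x)+\langle Ax,\bar y\rangle-g(\bar y)]$. AC-APDHG iteration: given $x_0=\widetilde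 x_0=\bar x_0\in X$, $\widetilde y_0\in Y$, $\mu_d>0$ and parameters $\beta_t\in[0,1)$, $\eta_t$, $\tau_t$, $\widetilde\tau_t$, set $y_0=\arg\min_{y\in Y}\{\langle-Ax_0,y\rangle+g(y)+\frac{\mu_d}{2}\|\widetilde y_0-y\|^2\}$, and for $t=1,2,\dots$ - $x_t=\arg\min_{x\in X}\{\eta_t\langle A^\top y_{t-1}+\nabla f(\widetilde x_{t-1}),x\rangle+\frac12\|\bar x_{t-1}-x\|^2\}$, - $\bar x_t=(1-\beta_t)\bar x_{t-1}+\beta_tx_t$, - $\widetilde x_t=(x_t+\widetilde\tau_t\widetilde x_{t-1})/(1+\widetilde\tau_t)$, - $y_t=\arg\min_{y\in Y}\{\langle-Ax_t,y\rangle+g(y)+\frac{\mu_d}{2}\|\widetilde y_0-y\|^2+\frac{\tau_t}{2}\|y_{t-1}-y\|^2\}$. Local estimates: $L_{A,t}=\frac{\|A^\top(y_t-y_{t-1})\|}{\|y_t-y_{t-1}\|}$ for $t\ge1$; $L_{f,1}=\frac{\|\nabla f(\widetilde x_1)-\nabla f(\widetilde x_0)\|}{\|\widetilde x_1-\widetilde x_0\|}$; $L_{f,t}=\frac{\|\nabla f(\widetilde x_t)-\nabla f(\widetilde x_{t-1})\|^2}{2[f(\widetilde x_{t-1})-f(\widetilde x_t)-\langle\nabla f(\widetilde x_t),\widetilde x_{t-1}-\widetilde x_t\rangle]}$ for $t\ge2$. Conventions: $0/0=0$, $a/0=+\infty$ for $a>0$ (so $0^{-1}=+\infty$), and $(+\infty)^{-1}=0$.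 The parameters may depend on previously computed iterates. *)

theory Defs
  imports "HOL-Analysis.Analysis"
begin

definition lsc_on :: "'a::topological_space set \<Rightarrow> ('a \<Rightarrow> real) \<Rightarrow> bool" where
  "lsc_on S g \<longleftrightarrow> (\<forall>y\<in>S. \<forall>c < g y. eventually (\<lambda>u. c < g u) (at y within S))"

text \<open>
  A function on \<open>X\<close> is a total function used only on \<open>X\<close>, and \<open>f'\<close> is its gradient map. Where
  \<open>X\<close> has no interior, the derivative within \<open>X\<close> need not determine the gradient vector; \<open>f'\<close> is
  then any choice of gradient that satisfies the two-sided inequality.
\<close>

definition smooth_convex_on ::
  "(real^'n) set \<Rightarrow> (real^'n \<Rightarrow> real) \<Rightarrow> (real^'n \<Rightarrow> real^'n) \<Rightarrow> real \<Rightarrow> bool" where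
  "smooth_convex_on X f f' Lf \<longleftrightarrow>
     convex_on X f \<and>
     (\<forall>x\<in>X. (f has_derivative (\<lambda>h. f' x \<bullet> h)) (at x within X)) \<and>
     Lf > 0 \<and>
     (\<forall>x\<in>X. \<forall>y\<in>X.
        1 / (2 * Lf) * (norm (f' x - f' y))\<^sup>2 \<le> f y - f x - f' x \<bullet> (y - x) \<and>
        f y - f x - f' x \<bullet> (y - x) \<le> Lf / 2 * (norm (x - y))\<^sup>2)"

definition saddle_fun ::
  "real^'n^'m \<Rightarrow> (real^'n \<Rightarrow> real) \<Rightarrow> (real^'m \<Rightarrow> real) \<Rightarrow> real^'n \<Rightarrow> real^'m \<Rightarrow> real" where
  "saddle_fun A f g x y = f x + (A *v x) \<bullet> y - g y"

definition saddle_point ::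
  "'a set \<Rightarrow> 'b set \<Rightarrow> ('a \<Rightarrow> 'b \<Rightarrow> real) \<Rightarrow> 'a \<Rightarrow> 'b \<Rightarrow> bool" where
  "saddle_point X Y F xs ys \<longleftrightarrow>
     xs \<in> X \<and> ys \<in> Y \<and> (\<forall>x\<in>X. \<forall>y\<in>Y. F xs y \<le> F xs ys \<and> F xs ys \<le> F x ys)"

definition gap_Q ::
  "real^'n^'m \<Rightarrow> (real^'n \<Rightarrow> real) \<Rightarrow> (real^'m \<Rightarrow> real) \<Rightarrow>
   (real^'n) \<times> (real^'m) \<Rightarrow> (real^'n) \<times> (real^'m) \<Rightarrow> real" where
  "gap_Q A f g zb z =
     saddle_fun A f g (fst zb) (snd z) - saddle_fun A f g (fst z) (snd zb)"

text \<open>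
  The step sizes are arbitrary sequences, so they may depend on the iterates. All minimized functions
  are strongly convex, hence the minimizers are unique. The points \<open>xt t\<close>, \<open>xb t\<close> and \<open>yt0\<close> stand
  for $\widetilde x_t$, $\bar x_t$ and $\widetilde y_0$, and \<open>\<tau>t t\<close> for $\widetilde\tau_t$.
\<close>

definition ac_apdhg ::
  "(real^'n) set \<Rightarrow> (real^'m) set \<Rightarrow> real^'n^'m \<Rightarrow> (real^'n \<Rightarrow> real^'n) \<Rightarrow> (real^'m \<Rightarrow> real) \<Rightarrow>
   real \<Rightarrow> (nat \<Rightarrow> real) \<Rightarrow> (nat \<Rightarrow> real) \<Rightarrow> (nat \<Rightarrow> real) \<Rightarrow> (nat \<Rightarrow> real) \<Rightarrow> real^'m \<Rightarrow>
   (nat \<Rightarrow> real^'n) \<Rightarrow> (nat \<Rightarrow> real^'n) \<Rightarrow> (nat \<Rightarrow> real^'n) \<Rightarrow> (nat \<Rightarrow> real^'m) \<Rightarrow> bool" where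
  "ac_apdhg X Y A f' g \<mu> \<beta> \<eta> \<tau> \<tau>t yt0 x xt xb y \<longleftrightarrow>
     x 0 \<in> X \<and> xt 0 = x 0 \<and> xb 0 = x 0 \<and> yt0 \<in> Y \<and>
     is_arg_min (\<lambda>v. (- (A *v x 0)) \<bullet> v + g v + \<mu> / 2 * (norm (yt0 - v))\<^sup>2)
       (\<lambda>v. v \<in> Y) (y 0) \<and>
     (\<forall>t\<ge>1.
        is_arg_min
          (\<lambda>u. \<eta> t * ((transpose A *v y (t - 1) + f' (xt (t - 1))) \<bullet> u)
               + 1 / 2 * (norm (xb (t - 1) - u))\<^sup>2)
          (\<lambda>u. u \<in> X) (x t) \<and>
        xb t = (1 - \<beta> t) *\<^sub>R xb (t - 1) + \<beta> t *\<^sub>R x t \<and>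
        xt t = (x t + \<tau>t t *\<^sub>R xt (t - 1)) /\<^sub>R (1 + \<tau>t t) \<and>
        is_arg_min
          (\<lambda>v. (- (A *v x t)) \<bullet> v + g v + \<mu> / 2 * (norm (yt0 - v))\<^sup>2
               + \<tau> t / 2 * (norm (y (t - 1) - v))\<^sup>2)
          (\<lambda>v. v \<in> Y) (y t))"

text \<open>
  Division and inverse on \<^typ>\<open>ereal\<close> implement exactly the conventions
  \<open>0 / 0 = 0\<close>, \<open>a / 0 = \<infinity>\<close> for \<open>a > 0\<close>, \<open>inverse 0 = \<infinity>\<close> and \<open>inverse \<infinity> = 0\<close>.
\<close>

definition LA :: "real^'n^'m \<Rightarrow> (nat \<Rightarrow> real^'m) \<Rightarrow> nat \<Rightarrow> ereal" where
  "LA A y t =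
     ereal (norm (transpose A *v (y t - y (t - 1)))) / ereal (norm (y t - y (t - 1)))"

definition LF ::
  "(real^'n \<Rightarrow> real) \<Rightarrow> (real^'n \<Rightarrow> real^'n) \<Rightarrow> (nat \<Rightarrow> real^'n) \<Rightarrow> nat \<Rightarrow> ereal" where
  "LF f f' xt t =
     (if t = 1 then ereal (norm (f' (xt 1) - f' (xt 0))) / ereal (norm (xt 1 - xt 0))
      else ereal ((norm (f' (xt t) - f' (xt (t - 1))))\<^sup>2) /
           ereal (2 * (f (xt (t - 1)) - f (xt t) - f' (xt t) \<bullet> (xt (t - 1) - xt t))))"

lemma ereal_division_conventions:
  "(0::ereal) / 0 = 0" "a > 0 \<Longrightarrow> ereal a / 0 = \<infinity>"
  "inverse (0::ereal) = \<infinity>" "inverse (\<infinity>::ereal) = 0"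
  by (simp_all add: divide_ereal_def zero_ereal_def)

text \<open>These two estimates are always finite, so taking their real value loses nothing.\<close>

lemma LA_finite: "\<bar>LA A y t\<bar> \<noteq> \<infinity>"
  by (cases "y t = y (t - 1)") (simp_all add: LA_def divide_ereal_def flip: zero_ereal_def)

lemma LF_1_finite: "\<bar>LF f f' xt 1\<bar> \<noteq> \<infinity>"
  by (cases "xt 1 = xt 0") (simp_all add: LF_def divide_ereal_def flip: zero_ereal_def)

definition weighted_avg :: "(nat \<Rightarrow> real) \<Rightarrow> (nat \<Rightarrow> 'a::real_vector) \<Rightarrow> nat \<Rightarrow> 'a" where
  "weighted_avg \<eta> u k = (\<Sum>t=1..k. \<eta> (t + 1) *\<^sub>R u t) /\<^sub>R (\<Sum>t=1..k. \<eta> (t + 1))"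

definition ytilde ::
  "real \<Rightarrow> (nat \<Rightarrow> real) \<Rightarrow> (nat \<Rightarrow> real) \<Rightarrow> (nat \<Rightarrow> 'a::real_vector) \<Rightarrow> nat \<Rightarrow> 'a" where
  "ytilde \<mu> \<eta> \<tau> y k =
     ((\<Sum>t=1..k-1. (\<eta> (t + 1) * (\<mu> + \<tau> t) - \<eta> (t + 2) * \<tau> (t + 1)) *\<^sub>R y t)
        + (\<eta> (k + 1) * (\<mu> + \<tau> k)) *\<^sub>R y k)
     /\<^sub>R (\<mu> * (\<Sum>t=1..k. \<eta> (t + 1)))"

end

theory Submission
  imports Defs
begin

text \<open>
  Let \<open>grad t\<close> denote \<open>A\<^sup>T y t + f' (xt t)\<close>. Convexity of \<open>f\<close> and the optimality
  of \<open>y t\<close> bound the gap of step \<open>t\<close> by the inner product of \<open>grad t\<close> with \<open>x t - u\<close>, minus two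
  surpluses: the proximal term of the dual step and the Bregman distance of \<open>f\<close> between the last two
  gradient points (\<open>step_gap_le\<close>). It remains to bound this inner product although \<open>x t\<close> was computed with
  \<open>grad (t - 1)\<close>.

  For this the inner product is split at \<open>x (t + 1)\<close>, which was computed with \<open>grad t\<close>. The optimality of
  \<open>x (t + 1)\<close>, tested against \<open>u\<close>, gives telescoping distances to \<open>u\<close> once the proximal centres
  \<open>xb\<close> are expressed as running averages. The optimality of \<open>x t\<close>, tested against \<open>x (t + 1)\<close>, deals with the rest
  up to the error from replacing \<open>grad t\<close> by \<open>grad (t - 1)\<close> (\<open>primal_step\<close>). All remaining movement
  terms form a quadratic form in \<open>x (t + 1) - xb t\<close> and \<open>x t - xb (t - 1)\<close>. The condition
  \<open>\<eta> (t + 1) \<le> 2 (1 - \<beta>)\<^sup>2 \<eta> t\<close> makes it dominate one eighth of the squared primal movement, up to a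
  telescoping quarter (\<open>movement_form_bound\<close>). This eighth together with the two surpluses pays for the error, because
  the step sizes obey the local estimates (\<open>gradient_change_absorbed\<close>).

  In the first step \<open>\<tau>\<close> and \<open>\<tau>t\<close> vanish and there is no surplus. There the change of the gradient is
  Lipschitz in \<open>x 1 - x 0\<close> by strong convexity in \<open>y\<close> (\<open>first_gradient_change\<close>), and this leaves the
  term in \<open>norm (x 1 - x 0)\<close> in the result (\<open>primal_step_first\<close>). The estimates are summed with weights
  \<open>\<eta> (t + 1)\<close> (\<open>sum_step_gap_le\<close>), and Jensen's inequality passes to the averages
  (\<open>averaged_gap_le_sum\<close>).
\<close>

section \<open>Minimizers of strongly convex functions\<close>

lemma norm_diff_convex_comb:
  fixes p a b :: "'a::real_inner"
  shows "(norm (p - ((1 - s) *\<^sub>R a + s *\<^sub>R b)))\<^sup>2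
    = (1 - s) * (norm (p - a))\<^sup>2 + s * (norm (p - b))\<^sup>2 - s * (1 - s) * (norm (a - b))\<^sup>2"
  by (simp add: power2_norm_eq_inner inner_diff_left inner_diff_right inner_add_left
      inner_add_right inner_commute) algebra

text \<open>
  Quadratic growth at a minimizer: compare the minimizer \<open>a\<close> with points close to it on the segment
  towards \<open>v\<close>, where strong convexity improves on the convexity bound by a term of first order in the
  distance. Two proximal centres occur because the dual step has two.
\<close>

lemma argmin_prox_gap:
  fixes h :: "'a::real_inner \<Rightarrow> real"
  assumes h: "convex_on S h"
    and min: "is_arg_min (\<lambda>v. h v + \<kappa> / 2 * (norm (p - v))\<^sup>2 + \<kappa>' / 2 * (norm (q - v))\<^sup>2)
       (\<lambda>v. v \<in> S) a"
    and v: "v \<in> S"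
  shows "h a + \<kappa> / 2 * (norm (p - a))\<^sup>2 + \<kappa>' / 2 * (norm (q - a))\<^sup>2
      + (\<kappa> + \<kappa>') / 2 * (norm (a - v))\<^sup>2
    \<le> h v + \<kappa> / 2 * (norm (p - v))\<^sup>2 + \<kappa>' / 2 * (norm (q - v))\<^sup>2"
proof -
  define F where "F v = h v + \<kappa> / 2 * (norm (p - v))\<^sup>2 + \<kappa>' / 2 * (norm (q - v))\<^sup>2" for v
  define N where "N = (\<kappa> + \<kappa>') / 2 * (norm (a - v))\<^sup>2"
  have a: "a \<in> S" and Fa: "\<And>w. w \<in> S \<Longrightarrow> F a \<le> F w"
    using min by (auto simp: is_arg_min_linorder F_def)
  have "F a \<le> F v - (1 - s) * N" if s: "0 < s" "s < 1" for s :: real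
  proof -
    define w where "w = (1 - s) *\<^sub>R a + s *\<^sub>R v"
    have w: "w \<in> S"
      using convex_on_imp_convex[OF h] a v s by (simp add: convexD w_def)
    have "h w \<le> (1 - s) * h a + s * h v"
      using convex_onD[OF h, of s a v] a v s by (simp add: w_def)
    moreover have "F w - h w = (1 - s) * (F a - h a) + s * (F v - h v) - s * (1 - s) * N"
      unfolding F_def N_def w_def norm_diff_convex_comb by (simp add: field_simps)
    ultimately have "F w \<le> (1 - s) * F a + s * F v - s * (1 - s) * N"
      by (simp add: algebra_simps)
    with Fa[OF w] have "s * F a \<le> s * (F v - (1 - s) * N)"
      by (simp add: algebra_simps)
    then show ?thesis using s by simp
  qed
  \<comment> \<open>Letting \<open>s\<close> tend to zero recovers the full quadratic term.\<close>
  then have ev: "\<forall>\<^sub>F s in at_right 0. F a \<le> F v - (1 - s) * N"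
    by (auto simp: eventually_at_right_field intro: exI[of _ 1])
  have "((\<lambda>s. F v - (1 - s) * N) \<longlongrightarrow> F v - (1 - 0) * N) (at_right 0)"
    by (intro tendsto_intros)
  from tendsto_lowerbound[OF this ev] show ?thesis
    by (simp add: F_def N_def)
qed

corollary argmin_linear_prox:
  fixes c p a v :: "'a::real_inner"
  assumes S: "convex S"
    and min: "is_arg_min (\<lambda>u. \<eta> * (c \<bullet> u) + 1 / 2 * (norm (p - u))\<^sup>2) (\<lambda>u. u \<in> S) a"
    and v: "v \<in> S"
  shows "\<eta> * (c \<bullet> (a - v)) \<le> (a - p) \<bullet> (v - a)"
proof -
  have "convex_on S (\<lambda>u. \<eta> * (c \<bullet> u))"
    using S by (intro convex_onI) (auto simp: inner_add_right algebra_simps)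
  from argmin_prox_gap[OF this, of 1 p 0 0 a v] min v
  show ?thesis
    by (simp add: power2_norm_eq_inner inner_diff_left inner_diff_right inner_commute algebra_simps)
qed

section \<open>The primal step\<close>

text \<open>
  The error of testing with \<open>x1\<close> instead of \<open>x2\<close> is moved to the optimality condition of the previous
  step, which controls the direction \<open>x1 - x2\<close> for the old gradient \<open>G\<close>. Since \<open>x2\<close> is an
  affine combination of the running averages \<open>b1\<close> and \<open>b2\<close>, the three-point identity of the proximal step
  becomes a telescoping one for the averages, with the factor \<open>1 / \<beta>\<close>.
\<close>

lemma primal_step:
  fixes G G' x x1 x2 b0 b1 b2 :: "'a::real_inner"
  assumes opt: "\<eta>' * (G' \<bullet> (x2 - x)) \<le> (x2 - b1) \<bullet> (x - x2)"
    and prev: "\<eta> * (G \<bullet> (x1 - x2)) \<le> (x1 - b0) \<bullet> (x2 - x1)"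
    and b2: "b2 = (1 - \<beta>) *\<^sub>R b1 + \<beta> *\<^sub>R x2"
    and pos: "\<eta> > 0" "\<eta>' > 0" "\<beta> > 0"
  shows "\<eta>' * (G' \<bullet> (x1 - x))
    \<le> ((norm (b1 - x))\<^sup>2 - (norm (b2 - x))\<^sup>2) / (2 * \<beta>) - (1 - \<beta> / 2) * (norm (x2 - b1))\<^sup>2
      + \<eta>' / \<eta> * ((x1 - b0) \<bullet> (x2 - x1)) + \<eta>' * ((G' - G) \<bullet> (x1 - x2))"
proof -
  have "(norm (b2 - x))\<^sup>2 = (1 - \<beta>) * (norm (b1 - x))\<^sup>2 + \<beta> * (norm (x2 - x))\<^sup>2
      - \<beta> * (1 - \<beta>) * (norm (x2 - b1))\<^sup>2"
    using norm_diff_convex_comb[of x \<beta> b1 x2] by (simp add: b2 norm_minus_commute)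
  then have "((norm (b1 - x))\<^sup>2 - (norm (b2 - x))\<^sup>2) / (2 * \<beta>) - (1 - \<beta> / 2) * (norm (x2 - b1))\<^sup>2
      = ((norm (b1 - x))\<^sup>2 - (norm (x2 - x))\<^sup>2 - (norm (x2 - b1))\<^sup>2) / 2"
    using pos by (simp add: field_simps)
  also have "\<dots> = (x2 - b1) \<bullet> (x - x2)"
    by (simp add: power2_norm_eq_inner inner_diff_left inner_diff_right inner_commute field_simps)
  finally have 1: "\<eta>' * (G' \<bullet> (x2 - x)) \<le> ((norm (b1 - x))\<^sup>2 - (norm (b2 - x))\<^sup>2) / (2 * \<beta>)
      - (1 - \<beta> / 2) * (norm (x2 - b1))\<^sup>2"
    using opt by simp
  have "\<eta>' / \<eta> * (\<eta> * (G \<bullet> (x1 - x2))) \<le> \<eta>' / \<eta> * ((x1 - b0) \<bullet> (x2 - x1))"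
    using prev pos by (intro mult_left_mono) auto
  then have 2: "\<eta>' * (G \<bullet> (x1 - x2)) \<le> \<eta>' / \<eta> * ((x1 - b0) \<bullet> (x2 - x1))"
    using pos by simp
  have "\<eta>' * (G' \<bullet> (x1 - x)) = \<eta>' * (G' \<bullet> (x2 - x)) + \<eta>' * (G \<bullet> (x1 - x2))
      + \<eta>' * ((G' - G) \<bullet> (x1 - x2))"
    by (simp add: inner_diff_left inner_diff_right algebra_simps)
  with 1 2 show ?thesis by linarith
qed

text \<open>
  Here \<open>u\<close> and \<open>v\<close> are the displacements of the new and the old iterate from their proximal centres, so that
  \<open>u - s *\<^sub>R v\<close> is the movement between the two iterates. The bound \<open>r \<le> 2 s\<^sup>2\<close> is what makes
  \<open>s / 2 * (norm u)\<^sup>2 - r * (u \<bullet> v) + r * s * (norm v)\<^sup>2\<close> positive semidefinite: it is a perfect square at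
  equality. The rest is the parallelogram identity.
\<close>

lemma movement_form_bound:
  fixes u v :: "'a::real_inner"
  assumes s: "0 < s" "s \<le> 1" and r: "0 \<le> r" "r \<le> 2 * s\<^sup>2"
  shows "(norm (u - s *\<^sub>R v))\<^sup>2 / 8
    \<le> (1 / 4 + s / 2) * (norm u)\<^sup>2 - r * (v \<bullet> (u - s *\<^sub>R v)) + (norm v)\<^sup>2 / 4"
proof -
  have "s\<^sup>2 * (norm v)\<^sup>2 \<le> 1 * (norm v)\<^sup>2"
    using s by (intro mult_right_mono) (auto simp: power_le_one)
  moreover have "r / (2 * s) \<le> s"
    using s r by (simp add: field_simps power2_eq_square)
  ultimately have "0 \<le> (norm (u + s *\<^sub>R v))\<^sup>2 / 8 + ((norm v)\<^sup>2 - s\<^sup>2 * (norm v)\<^sup>2) / 4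
      + s / 2 * (norm (u - (r / s) *\<^sub>R v))\<^sup>2 + (s - r / (2 * s)) * r * (norm v)\<^sup>2"
    using s r by (intro add_nonneg_nonneg mult_nonneg_nonneg) auto
  also have "\<dots> = (1 / 4 + s / 2) * (norm u)\<^sup>2 - r * (v \<bullet> (u - s *\<^sub>R v)) + (norm v)\<^sup>2 / 4
      - (norm (u - s *\<^sub>R v))\<^sup>2 / 8"
    using s by (simp add: power2_norm_eq_inner inner_diff_left inner_diff_right inner_add_left
        inner_add_right inner_commute) (simp add: field_simps power2_eq_square)
  finally show ?thesis by simp
qed

text \<open>
  The term \<open>E\<close> stands for what the dual step and the convexity of \<open>f\<close> will pay.
\<close>

lemma primal_step_average:
  fixes G G' x x1 x2 b0 b1 b2 :: "'a::real_inner"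
  assumes opt: "\<eta>' * (G' \<bullet> (x2 - x)) \<le> (x2 - b1) \<bullet> (x - x2)"
    and prev: "\<eta> * (G \<bullet> (x1 - x2)) \<le> (x1 - b0) \<bullet> (x2 - x1)"
    and b1: "b1 = (1 - \<beta>) *\<^sub>R b0 + \<beta> *\<^sub>R x1"
    and b2: "b2 = (1 - \<beta>) *\<^sub>R b1 + \<beta> *\<^sub>R x2"
    and pos: "\<eta> > 0" "\<eta>' > 0" "0 < \<beta>" "\<beta> < 1" and \<eta>': "\<eta>' \<le> 2 * (1 - \<beta>)\<^sup>2 * \<eta>"
    and err: "\<eta>' * ((G' - G) \<bullet> (x1 - x2)) \<le> E + (norm (x1 - x2))\<^sup>2 / 8"
  shows "\<eta>' * (G' \<bullet> (x1 - x))
    \<le> ((norm (b1 - x))\<^sup>2 - (norm (b2 - x))\<^sup>2) / (2 * \<beta>)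
      + ((norm (x1 - b0))\<^sup>2 - (norm (x2 - b1))\<^sup>2) / 4 + E"
proof -
  have d: "x2 - x1 = (x2 - b1) - (1 - \<beta>) *\<^sub>R (x1 - b0)"
    by (simp add: b1 algebra_simps)
  have "(norm (x2 - x1))\<^sup>2 / 8 \<le> (1 / 4 + (1 - \<beta>) / 2) * (norm (x2 - b1))\<^sup>2
      - \<eta>' / \<eta> * ((x1 - b0) \<bullet> (x2 - x1)) + (norm (x1 - b0))\<^sup>2 / 4"
    unfolding d by (rule movement_form_bound) (use pos \<eta>' in \<open>auto simp: field_simps\<close>)
  moreover have "(1 / 4 + (1 - \<beta>) / 2) * (norm (x2 - b1))\<^sup>2
      = (1 - \<beta> / 2) * (norm (x2 - b1))\<^sup>2 - (norm (x2 - b1))\<^sup>2 / 4"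
    by (simp add: field_simps)
  ultimately show ?thesis
    using primal_step[OF opt prev b2 pos(1-3)] err
    unfolding norm_minus_commute[of x1 x2] diff_divide_distrib by linarith
qed

text \<open>
  In the first step the centre does not move, and the error has no surplus to be charged to. Its
  part in \<open>x2 - b0\<close> is absorbed by the proximal terms, where \<open>\<eta>' \<le> (1 - \<beta>) * \<eta>\<close> leaves just enough room
  for the quarter that starts the telescoping. The factor \<open>5 / 4\<close> is \<open>1\<close> from the triangle inequality for
  \<open>x1 - x2\<close> plus \<open>1 / 4\<close> from completing the square.
\<close>

lemma primal_step_first:
  fixes G G' x x1 x2 b0 b2 :: "'a::real_inner"
  assumes opt: "\<eta>' * (G' \<bullet> (x2 - x)) \<le> (x2 - b0) \<bullet> (x - x2)"
    and prev: "\<eta> * (G \<bullet> (x1 - x2)) \<le> (x1 - b0) \<bullet> (x2 - x1)"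
    and b2: "b2 = (1 - \<beta>) *\<^sub>R b0 + \<beta> *\<^sub>R x2"
    and pos: "\<eta> > 0" "\<eta>' > 0" "0 < \<beta>" "\<beta> < 1" and \<eta>': "\<eta>' \<le> (1 - \<beta>) * \<eta>"
    and lip: "norm (G' - G) \<le> K * norm (x1 - b0)" and K: "0 \<le> K" "4 * \<eta>' * K \<le> 1"
  shows "\<eta>' * (G' \<bullet> (x1 - x))
    \<le> ((norm (b0 - x))\<^sup>2 - (norm (b2 - x))\<^sup>2) / (2 * \<beta>) - (norm (x2 - b0))\<^sup>2 / 4
      + (5 * \<eta>' * K / 4 - \<eta>' / (2 * \<eta>)) * (norm (x1 - b0))\<^sup>2"
proof -
  define a b where "a = norm (x1 - b0)" and "b = norm (x2 - b0)"
  have tri: "norm (x1 - x2) \<le> a + b"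
    unfolding a_def b_def using norm_triangle_ineq4[of "x1 - b0" "x2 - b0"] by simp
  have "(G' - G) \<bullet> (x1 - x2) \<le> norm (G' - G) * norm (x1 - x2)"
    by (rule norm_cauchy_schwarz)
  also have "\<dots> \<le> (K * a) * (a + b)"
    using lip tri K by (intro mult_mono) (auto simp: a_def)
  also have "\<dots> = K * (5 / 4 * a\<^sup>2 + b\<^sup>2 - (a / 2 - b)\<^sup>2)"
    by (simp add: power2_eq_square algebra_simps)
  also have "\<dots> \<le> K * (5 / 4 * a\<^sup>2 + b\<^sup>2)"
    using K by (intro mult_left_mono) auto
  finally have "\<eta>' * ((G' - G) \<bullet> (x1 - x2)) \<le> \<eta>' * (K * (5 / 4 * a\<^sup>2 + b\<^sup>2))"
    using pos by (intro mult_left_mono) auto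
  moreover have "\<eta>' * K * b\<^sup>2 \<le> 1 / 4 * b\<^sup>2"
    using K by (intro mult_right_mono) auto
  ultimately have err: "\<eta>' * ((G' - G) \<bullet> (x1 - x2)) \<le> 5 * \<eta>' * K / 4 * a\<^sup>2 + b\<^sup>2 / 4"
    by (simp add: algebra_simps)
  have "(norm (x2 - x1))\<^sup>2 \<ge> 0" by simp
  then have "(x1 - b0) \<bullet> (x2 - x1) \<le> (b\<^sup>2 - a\<^sup>2) / 2"
    unfolding a_def b_def
    by (simp add: power2_norm_eq_inner inner_diff_left inner_diff_right inner_commute)
  then have "\<eta>' / \<eta> * ((x1 - b0) \<bullet> (x2 - x1)) \<le> \<eta>' / \<eta> * ((b\<^sup>2 - a\<^sup>2) / 2)"
    using pos by (intro mult_left_mono) auto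
  moreover have "\<eta>' / \<eta> * b\<^sup>2 \<le> (1 - \<beta>) * b\<^sup>2"
    using pos \<eta>' by (intro mult_right_mono) (auto simp: field_simps)
  ultimately show ?thesis
    using primal_step[OF opt prev b2 pos(1-3)] err
    unfolding a_def[symmetric] b_def[symmetric]
    by (simp add: algebra_simps diff_divide_distrib)
qed

section \<open>Local estimates\<close>

text \<open>
  The case \<open>\<tau> = 0\<close> is included, since the step-size rule allows it exactly when the local
  estimate \<open>l\<close> vanishes.
\<close>

lemma young_weighted:
  fixes a p w l \<tau> :: real
  assumes "a\<^sup>2 = l * p" "\<tau> = 0 \<Longrightarrow> l = 0" "0 \<le> \<tau>" "0 \<le> l" "0 \<le> p" "0 \<le> a" "0 \<le> w"
  shows "a * w \<le> \<tau> * p / 2 + l / \<tau> * w\<^sup>2 / 2"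
proof (cases "\<tau> = 0")
  case True
  then have "a = 0" using assms by simp
  then show ?thesis using True by simp
next
  case False
  then have \<tau>: "\<tau> > 0" using assms by simp
  have "(a * w)\<^sup>2 = (\<tau> * p) * (l / \<tau> * w\<^sup>2)"
    using \<tau> by (simp add: power_mult_distrib assms(1))
  then have "a * w = sqrt ((\<tau> * p) * (l / \<tau> * w\<^sup>2))"
    using assms by (metis real_sqrt_unique mult_nonneg_nonneg)
  also have "\<dots> \<le> (\<tau> * p + l / \<tau> * w\<^sup>2) / 2"
    using \<tau> assms by (intro arith_geo_mean_sqrt) auto
  finally show ?thesis by (simp add: add_divide_distrib)
qed

text \<open>
  A positive step size rules out an infinite sum of ratios, so the extended-real rule is a real
  inequality together with the statement that no positive estimate is divided by zero.
\<close>

lemma step_le_inverse_ratio_sum: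
  fixes \<eta> l l' \<tau> \<tau>' :: real
  assumes "\<eta> > 0" "l \<ge> 0" "l' \<ge> 0" "\<tau> \<ge> 0" "\<tau>' \<ge> 0"
    and le: "ereal \<eta> \<le> inverse (4 * ereal l / ereal \<tau> + 4 * ereal l' / ereal \<tau>')"
  shows "\<tau> = 0 \<Longrightarrow> l = 0" "\<tau>' = 0 \<Longrightarrow> l' = 0" "4 * \<eta> * (l / \<tau> + l' / \<tau>') \<le> 1"
proof -
  have div: "4 * ereal a / ereal b = (if b = 0 \<and> a \<noteq> 0 then \<infinity> else ereal (4 * a / b))"
    if "a \<ge> 0" for a b :: real
    using that by (auto simp: divide_ereal_def zero_ereal_def[symmetric] divide_inverse)
  show l: "l = 0" if "\<tau> = 0"
    using le that assms by (auto simp: div split: if_splits)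
  show l': "l' = 0" if "\<tau>' = 0"
    using le that assms by (auto simp: div split: if_splits)
  define q where "q = l / \<tau> + l' / \<tau>'"
  have "ereal \<eta> \<le> inverse (ereal (4 * q))"
    using le l l' assms by (auto simp: div q_def algebra_simps split: if_splits)
  moreover have "0 \<le> q"
    using assms by (auto simp: q_def)
  ultimately have "4 * \<eta> * q \<le> 1"
    using \<open>\<eta> > 0\<close> by (cases "q = 0") (auto simp: field_simps)
  then show "4 * \<eta> * (l / \<tau> + l' / \<tau>') \<le> 1"
    by (simp add: q_def)
qed

text \<open>
  The defining relation of each local estimate, in product form, holds for vanishing denominators
  as well: their numerators vanish too. For the later estimates of \<open>f\<close> this is the lower bound on the Bregman
  distance in \<open>smooth_convex_on\<close>.
\<close>

lemma LA_real:
  obtains l where "LA A y t = ereal l" "0 \<le> l"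
    "norm (transpose A *v (y t - y (t - 1))) = l * norm (y t - y (t - 1))"
proof (cases "y t = y (t - 1)")
  case True
  then show ?thesis
    by (intro that[of 0]) (auto simp: LA_def zero_ereal_def[symmetric] divide_ereal_def)
next
  case False
  then show ?thesis
    by (intro that[of "norm (transpose A *v (y t - y (t - 1))) / norm (y t - y (t - 1))"])
      (auto simp: LA_def)
qed

lemma LF_first_real:
  obtains l where "LF f f' xt 1 = ereal l" "0 \<le> l"
    "norm (f' (xt 1) - f' (xt 0)) = l * norm (xt 1 - xt 0)"
proof (cases "xt 1 = xt 0")
  case True
  then show ?thesis
    by (intro that[of 0]) (auto simp: LF_def zero_ereal_def[symmetric] divide_ereal_def)
next
  case False
  then show ?thesis
    by (intro that[of "norm (f' (xt 1) - f' (xt 0)) / norm (xt 1 - xt 0)"]) (auto simp: LF_def)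
qed

lemma LF_real:
  assumes f: "smooth_convex_on X f f' Lf" and "xt t \<in> X" "xt (t - 1) \<in> X" and t: "t \<noteq> 1"
  obtains l where "LF f f' xt t = ereal l" "0 \<le> l"
    "(norm (f' (xt t) - f' (xt (t - 1))))\<^sup>2
      = l * (2 * (f (xt (t - 1)) - f (xt t) - f' (xt t) \<bullet> (xt (t - 1) - xt t)))"
proof -
  define D where "D = f (xt (t - 1)) - f (xt t) - f' (xt t) \<bullet> (xt (t - 1) - xt t)"
  define N where "N = (norm (f' (xt t) - f' (xt (t - 1))))\<^sup>2"
  have L: "Lf > 0" "1 / (2 * Lf) * N \<le> D"
    using assms unfolding smooth_convex_on_def D_def N_def by auto
  have N0: "0 \<le> N" by (simp add: N_def)
  then have D0: "0 \<le> D" using L by (smt (verit) divide_nonneg_pos mult_nonneg_nonneg)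
  have LF: "LF f f' xt t = ereal N / ereal (2 * D)"
    using t by (simp add: LF_def N_def D_def)
  show ?thesis
  proof (cases "D = 0")
    case True
    then have "N = 0" using L N0 by (simp add: field_simps)
    then show ?thesis using True LF
      by (intro that[of 0], unfold N_def[symmetric] D_def[symmetric])
        (simp_all add: zero_ereal_def[symmetric] divide_ereal_def)
  next
    case False
    then show ?thesis using D0 N0 LF
      by (intro that[of "N / (2 * D)"], unfold N_def[symmetric] D_def[symmetric])
       (simp_all add: field_simps)
  qed
qed

section \<open>Averaging\<close>

lemma jensen_weighted:
  fixes u :: "nat \<Rightarrow> 'a::real_vector"
  assumes f: "convex_on C f" and W: "0 < sum w I" and I: "finite I"
    and u: "\<And>i. i \<in> I \<Longrightarrow> u i \<in> C" and w: "\<And>i. i \<in> I \<Longrightarrow> 0 \<le> w i"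
  shows "sum w I * f ((\<Sum>i\<in>I. w i *\<^sub>R u i) /\<^sub>R sum w I) \<le> (\<Sum>i\<in>I. w i * f (u i))"
proof -
  have "f (\<Sum>i\<in>I. (w i / sum w I) *\<^sub>R u i) \<le> (\<Sum>i\<in>I. w i / sum w I * f (u i))"
    using I W u w by (intro convex_on_sum[OF _ _ f])
      (auto simp: sum_divide_distrib[symmetric] convex_on_imp_convex[OF f])
  also have "(\<Sum>i\<in>I. (w i / sum w I) *\<^sub>R u i) = (\<Sum>i\<in>I. w i *\<^sub>R u i) /\<^sub>R sum w I"
    by (simp add: scaleR_right.sum divide_inverse mult.commute)
  also have "(\<Sum>i\<in>I. w i / sum w I * f (u i)) = (\<Sum>i\<in>I. w i * f (u i)) / sum w I"
    by (simp add: sum_divide_distrib)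
  finally show ?thesis using W by (simp add: field_simps)
qed

text \<open>
  The coefficient of \<open>a t\<close> after summation by parts of the differences
  \<open>(c + \<sigma> t) *\<^sub>R a t - \<sigma> t *\<^sub>R a (t - 1)\<close> with weights \<open>\<eta> (t + 1)\<close>. It is used with \<open>c = 1\<close> for the
  gradient points and with \<open>c = \<mu>\<close> for the dual iterates.
\<close>

definition shifted_weight ::
  "real \<Rightarrow> (nat \<Rightarrow> real) \<Rightarrow> (nat \<Rightarrow> real) \<Rightarrow> nat \<Rightarrow> nat \<Rightarrow> real" where
  "shifted_weight c \<eta> \<sigma> k t =
     \<eta> (t + 1) * (c + \<sigma> t) - (if t < k then \<eta> (t + 2) * \<sigma> (t + 1) else 0)"

lemma sum_shifted_weight_split:
  fixes a :: "nat \<Rightarrow> 'a::real_vector"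
  assumes "k \<ge> 1"
  shows "(\<Sum>t=1..k. shifted_weight c \<eta> \<sigma> k t *\<^sub>R a t)
    = (\<Sum>t=1..k - 1. (\<eta> (t + 1) * (c + \<sigma> t) - \<eta> (t + 2) * \<sigma> (t + 1)) *\<^sub>R a t)
      + (\<eta> (k + 1) * (c + \<sigma> k)) *\<^sub>R a k"
proof -
  obtain n where k: "k = Suc n" using assms by (cases k) auto
  show ?thesis
    unfolding k by (simp add: shifted_weight_def)
qed

lemma sum_shifted_weight:
  fixes a :: "nat \<Rightarrow> 'a::real_vector"
  assumes "k \<ge> 1" and \<sigma>: "\<sigma> 1 = 0"
  shows "(\<Sum>t=1..k. shifted_weight c \<eta> \<sigma> k t *\<^sub>R a t)
    = (\<Sum>t=1..k. \<eta> (t + 1) *\<^sub>R ((c + \<sigma> t) *\<^sub>R a t - \<sigma> t *\<^sub>R a (t - 1)))"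
  unfolding sum_shifted_weight_split[OF \<open>k \<ge> 1\<close>] using \<open>k \<ge> 1\<close>
proof (induction k rule: dec_induct)
  case base
  then show ?case using \<sigma> by simp
next
  case (step n)
  obtain m where "n = Suc m" using step by (cases n) auto
  with step show ?case by (simp add: algebra_simps)
qed

lemma sum_shifted_weight_total:
  assumes "k \<ge> 1" "\<sigma> 1 = 0"
  shows "sum (shifted_weight c \<eta> \<sigma> k) {1..k} = c * (\<Sum>t=1..k. \<eta> (t + 1))"
  using sum_shifted_weight[where \<sigma> = \<sigma>, OF assms, of c \<eta> "\<lambda>_. 1::real"]
  by (simp add: algebra_simps sum_distrib_left)

text \<open>
  Summation by parts turns the differences on the right into a combination with the shifted weights.
  Their total telescopes to \<open>c\<close> times the sum of the step sizes.
\<close>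

lemma jensen_shifted_weight:
  fixes u :: "nat \<Rightarrow> 'a::real_vector"
  assumes h: "convex_on C h" and k: "k \<ge> 1" and \<sigma>: "\<sigma> 1 = 0" and c: "c > 0"
    and u: "\<And>t. t \<ge> 1 \<Longrightarrow> u t \<in> C" and \<eta>: "\<And>t. t \<ge> 1 \<Longrightarrow> \<eta> t > 0" "\<And>t. t \<ge> 1 \<Longrightarrow> \<sigma> t \<ge> 0"
    and mono: "\<And>t. t \<ge> 1 \<Longrightarrow> \<eta> (t + 2) * \<sigma> (t + 1) \<le> \<eta> (t + 1) * (c + \<sigma> t)"
  shows "c * (\<Sum>t=1..k. \<eta> (t + 1))
      * h ((\<Sum>t=1..k. shifted_weight c \<eta> \<sigma> k t *\<^sub>R u t) /\<^sub>R (c * (\<Sum>t=1..k. \<eta> (t + 1))))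
    \<le> (\<Sum>t=1..k. \<eta> (t + 1) * ((c + \<sigma> t) * h (u t) - \<sigma> t * h (u (t - 1))))"
proof -
  have "0 < (\<Sum>t=1..k. \<eta> (t + 1))"
    using k \<eta> by (intro sum_pos) auto
  then have "0 < sum (shifted_weight c \<eta> \<sigma> k) {1..k}"
    using sum_shifted_weight_total[where \<sigma> = \<sigma>, OF k \<sigma>] c by simp
  moreover have "0 \<le> shifted_weight c \<eta> \<sigma> k t" if "t \<in> {1..k}" for t
    using that mono[of t] \<eta>(1)[of "t + 1"] \<eta>(2)[of t] c by (auto simp: shifted_weight_def)
  ultimately have "sum (shifted_weight c \<eta> \<sigma> k) {1..k}
      * h ((\<Sum>t=1..k. shifted_weight c \<eta> \<sigma> k t *\<^sub>R u t) /\<^sub>R sum (shifted_weight c \<eta> \<sigma> k) {1..k})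
      \<le> (\<Sum>t=1..k. shifted_weight c \<eta> \<sigma> k t * h (u t))"
    using u by (intro jensen_weighted[OF h]) auto
  then show ?thesis
    using sum_shifted_weight[where \<sigma> = \<sigma>, OF k \<sigma>, of c \<eta> "\<lambda>t. h (u t)"] sum_shifted_weight_total[where \<sigma> = \<sigma>, OF k \<sigma>]
    by simp
qed

lemma convex_on_norm_diff_sq: "convex_on UNIV (\<lambda>v::'a::real_inner. (norm (p - v))\<^sup>2)"
proof (rule convex_onI)
  fix t :: real and a b :: 'a
  assume "0 < t" "t < 1"
  then have "0 \<le> t * (1 - t) * (norm (a - b))\<^sup>2" by simp
  then show "(norm (p - ((1 - t) *\<^sub>R a + t *\<^sub>R b)))\<^sup>2 \<le> (1 - t) * (norm (p - a))\<^sup>2 + t * (norm (p - b))\<^sup>2"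
    by (simp only: norm_diff_convex_comb)
qed simp

section \<open>The iteration\<close>

locale ac_apdhg_run =
  fixes X :: "(real^'n) set" and Y :: "(real^'m) set"
    and A :: "real^'n^'m"
    and f :: "real^'n \<Rightarrow> real" and f' :: "real^'n \<Rightarrow> real^'n" and Lf :: real
    and g :: "real^'m \<Rightarrow> real"
    and \<mu> \<beta> :: real and \<beta>s \<eta> \<tau> \<tau>t :: "nat \<Rightarrow> real"
    and yt0 :: "real^'m"
    and x xt xb :: "nat \<Rightarrow> real^'n" and y :: "nat \<Rightarrow> real^'m"
  assumes f: "smooth_convex_on X f f' Lf"
    and g: "convex_on Y g"
    and iter: "ac_apdhg X Y A f' g \<mu> \<beta>s \<eta> \<tau> \<tau>t yt0 x xt xb y"
    and pos: "\<And>t. t \<ge> 1 \<Longrightarrow> \<eta> t > 0" "\<And>t. t \<ge> 1 \<Longrightarrow> \<tau> t \<ge> 0" "\<And>t. t \<ge> 1 \<Longrightarrow> \<tau>t t \<ge> 0"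
      "\<mu> > 0" "0 < \<beta>" "\<beta> < 1"
    and init: "\<tau> 1 = 0" "\<tau>t 1 = 0" "\<beta>s 1 = 0" "\<And>t. t \<ge> 2 \<Longrightarrow> \<beta>s t = \<beta>"
    and eta2: "ereal (\<eta> 2) \<le>
      min (ereal ((1 - \<beta>) * \<eta> 1))
          (inverse (4 * (LA A y 1)\<^sup>2 / ereal \<mu> + 4 * LF f f' xt 1))"
    and eta: "\<And>t. t \<ge> 3 \<Longrightarrow> ereal (\<eta> t) \<le>
      Min {ereal (2 * (1 - \<beta>)\<^sup>2 * \<eta> (t - 1)),
           ereal (\<tau>t (t - 2) + 1) / ereal (\<tau>t (t - 1)) * ereal (\<eta> (t - 1)),
           ereal (\<tau> (t - 2) + \<mu>) / ereal (\<tau> (t - 1)) * ereal (\<eta> (t - 1)),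
           inverse (4 * (LA A y (t - 1))\<^sup>2 / ereal (\<tau> (t - 1))
                    + 4 * LF f f' xt (t - 1) / ereal (\<tau>t (t - 1)))}"
begin

lemma convex_f: "convex_on X f"
  using f by (simp add: smooth_convex_on_def)

lemma convex_X: "convex X"
  using convex_f by (rule convex_on_imp_convex)

lemma f_above_tangent: "u \<in> X \<Longrightarrow> w \<in> X \<Longrightarrow> f u + f' u \<bullet> (w - u) \<le> f w"
  using f unfolding smooth_convex_on_def
  by (smt (verit) divide_nonneg_pos mult_nonneg_nonneg zero_le_power2)

lemma adjoint: "(A *v u) \<bullet> v = (transpose A *v v) \<bullet> u"
  by (metis dot_lmul_matrix inner_commute transpose_matrix_vector)

lemma starts: "x 0 \<in> X" "xt 0 = x 0" "xb 0 = x 0"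
  using iter unfolding ac_apdhg_def by auto

lemma updates:
  assumes "t \<ge> 1"
  shows "xb t = (1 - \<beta>s t) *\<^sub>R xb (t - 1) + \<beta>s t *\<^sub>R x t"
    and "xt t = (x t + \<tau>t t *\<^sub>R xt (t - 1)) /\<^sub>R (1 + \<tau>t t)"
    and "is_arg_min (\<lambda>u. \<eta> t * ((transpose A *v y (t - 1) + f' (xt (t - 1))) \<bullet> u)
        + 1 / 2 * (norm (xb (t - 1) - u))\<^sup>2) (\<lambda>u. u \<in> X) (x t)"
    and "is_arg_min (\<lambda>v. (- (A *v x t)) \<bullet> v + g v + \<mu> / 2 * (norm (yt0 - v))\<^sup>2
        + \<tau> t / 2 * (norm (y (t - 1) - v))\<^sup>2) (\<lambda>v. v \<in> Y) (y t)"
  using iter assms unfolding ac_apdhg_def by auto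

lemma x_in: "x t \<in> X"
  using starts updates(3)[of t] by (cases "t = 0") (auto simp: is_arg_min_def)

lemma y_in: "y t \<in> Y"
  using iter updates(4)[of t] by (cases "t = 0") (auto simp: is_arg_min_def ac_apdhg_def)

lemma xt_in: "xt t \<in> X"
proof (induction t)
  case 0
  then show ?case using starts by simp
next
  case (Suc t)
  have p: "0 \<le> \<tau>t (Suc t)" using pos(3) by simp
  then have "(1 / (1 + \<tau>t (Suc t))) *\<^sub>R x (Suc t) + (\<tau>t (Suc t) / (1 + \<tau>t (Suc t))) *\<^sub>R xt t \<in> X"
    using Suc x_in convex_X by (intro convexD) (auto simp: field_simps)
  then show ?case
    using updates(2)[of "Suc t"]
    by (simp add: scaleR_add_right divide_inverse mult.commute)
qed

lemma x_from_xt: "t \<ge> 1 \<Longrightarrow> x t = (1 + \<tau>t t) *\<^sub>R xt t - \<tau>t t *\<^sub>R xt (t - 1)"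
  using updates(2)[of t] pos(3)[of t] by simp

lemma first_iterates: "xt 1 = x 1" "xb 1 = x 0"
  using updates(1,2)[of 1] init starts by simp_all

lemma xb_step: "t \<ge> 2 \<Longrightarrow> xb t = (1 - \<beta>) *\<^sub>R xb (t - 1) + \<beta> *\<^sub>R x t"
  using updates(1)[of t] init by simp

definition grad :: "nat \<Rightarrow> real^'n" where
  "grad t = transpose A *v y t + f' (xt t)"

lemma primal_opt:
  assumes "t \<ge> 1" "u \<in> X"
  shows "\<eta> t * (grad (t - 1) \<bullet> (x t - u)) \<le> (x t - xb (t - 1)) \<bullet> (u - x t)"
  using argmin_linear_prox[OF convex_X updates(3)[OF assms(1)] assms(2)] by (simp add: grad_def)

lemma convex_dual_objective: "convex_on Y (\<lambda>v. (- (A *v u)) \<bullet> v + g v)"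
proof (rule convex_on_add[OF _ g])
  show "convex_on Y (\<lambda>v. (- (A *v u)) \<bullet> v)"
    using convex_on_imp_convex[OF g]
    by (intro convex_onI) (auto simp: inner_add_right algebra_simps)
qed

lemma dual_opt:
  assumes "t \<ge> 1" "v \<in> Y"
  shows "(A *v x t) \<bullet> (v - y t) + g (y t) - g v + \<mu> / 2 * (norm (yt0 - y t))\<^sup>2
      - \<mu> / 2 * (norm (yt0 - v))\<^sup>2
      + ((\<mu> + \<tau> t) * (norm (v - y t))\<^sup>2 - \<tau> t * (norm (v - y (t - 1)))\<^sup>2) / 2
    \<le> - (\<tau> t * (norm (y t - y (t - 1)))\<^sup>2 / 2)"
  using argmin_prox_gap[OF convex_dual_objective updates(4)[OF assms(1)] assms(2)]
  by (simp add: inner_diff_right norm_minus_commute diff_divide_distrib)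

text \<open>
  Because \<open>\<tau> 1 = 0\<close>, the points \<open>y 0\<close> and \<open>y 1\<close> minimize the same \<open>\<mu>\<close>-strongly convex
  function up to the linear terms given by \<open>A x 0\<close> and \<open>A x 1\<close>. Testing each with the other and adding
  gives strong monotonicity. In the first step it stands in for the proximal term in \<open>y\<close>, which is
  not there to absorb the dual movement.
\<close>

lemma dual_first_move: "\<mu> * (norm (y 1 - y 0))\<^sup>2 \<le> (A *v (x 1 - x 0)) \<bullet> (y 1 - y 0)"
proof -
  have "is_arg_min (\<lambda>v. (- (A *v x 0)) \<bullet> v + g v + \<mu> / 2 * (norm (yt0 - v))\<^sup>2
      + 0 / 2 * (norm (0 - v))\<^sup>2) (\<lambda>v. v \<in> Y) (y 0)"
    using iter by (simp add: ac_apdhg_def)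
  from argmin_prox_gap[OF convex_dual_objective this y_in[of 1]] dual_opt[of 1 "y 0"] y_in[of 0] init
  show ?thesis
    by (simp add: inner_diff_right inner_diff_left matrix_vector_mult_diff_distrib norm_minus_commute)
qed

section \<open>What the step-size rule provides\<close>

lemma eta_bounds:
  assumes "t \<ge> 3"
  shows "ereal (\<eta> t) \<le> ereal (2 * (1 - \<beta>)\<^sup>2 * \<eta> (t - 1))"
    and "ereal (\<eta> t) \<le> ereal (\<tau>t (t - 2) + 1) / ereal (\<tau>t (t - 1)) * ereal (\<eta> (t - 1))"
    and "ereal (\<eta> t) \<le> ereal (\<tau> (t - 2) + \<mu>) / ereal (\<tau> (t - 1)) * ereal (\<eta> (t - 1))"
    and "ereal (\<eta> t) \<le> inverse (4 * (LA A y (t - 1))\<^sup>2 / ereal (\<tau> (t - 1))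
                    + 4 * LF f f' xt (t - 1) / ereal (\<tau>t (t - 1)))"
  by (rule order_trans[OF eta[OF assms] Min_le], simp, simp)+

lemma eta_growth: "t \<ge> 2 \<Longrightarrow> \<eta> (t + 1) \<le> 2 * (1 - \<beta>)\<^sup>2 * \<eta> t"
  using eta_bounds(1)[of "t + 1"] by simp

text \<open>
  When the denominator \<open>c\<close> vanishes, the ratio condition imposes nothing, and the product form holds
  trivially.
\<close>

lemma product_le_of_ratio:
  assumes "ereal a \<le> ereal b / ereal c * ereal d" "c \<ge> 0" "b \<ge> 0" "d \<ge> 0"
  shows "a * c \<le> d * b"
  using assms by (cases "c = 0") (auto simp: field_simps)

text \<open>
  These two conditions say exactly that the coefficients obtained by collecting the terms
  \<open>f (xt t)\<close>, respectively \<open>(norm (v - y t))\<^sup>2\<close>, over all steps are nonnegative, which makes Jensen's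
  inequality applicable to them.
\<close>

lemma weights_nonneg:
  assumes "t \<ge> 1"
  shows "\<eta> (t + 2) * \<tau>t (t + 1) \<le> \<eta> (t + 1) * (1 + \<tau>t t)"
    and "\<eta> (t + 2) * \<tau> (t + 1) \<le> \<eta> (t + 1) * (\<mu> + \<tau> t)"
proof -
  have "\<eta> (t + 2) * \<tau>t (t + 1) \<le> \<eta> (t + 1) * (\<tau>t t + 1)"
    using eta_bounds(2)[of "t + 2"] pos(3)[of t] pos(3)[of "t + 1"] pos(1)[of "t + 1"] assms
    by (intro product_le_of_ratio) auto
  then show "\<eta> (t + 2) * \<tau>t (t + 1) \<le> \<eta> (t + 1) * (1 + \<tau>t t)"
    by (simp add: add.commute)
  have "\<eta> (t + 2) * \<tau> (t + 1) \<le> \<eta> (t + 1) * (\<tau> t + \<mu>)"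
    using eta_bounds(3)[of "t + 2"] pos(2)[of t] pos(2)[of "t + 1"] pos(1)[of "t + 1"] pos(4) assms
    by (intro product_le_of_ratio) auto
  then show "\<eta> (t + 2) * \<tau> (t + 1) \<le> \<eta> (t + 1) * (\<mu> + \<tau> t)"
    by (simp add: add.commute)
qed

definition bregman :: "nat \<Rightarrow> real" where
  "bregman t = f (xt (t - 1)) - f (xt t) - f' (xt t) \<bullet> (xt (t - 1) - xt t)"

lemma bregman_nonneg: "0 \<le> bregman t"
  using f_above_tangent[OF xt_in[of t] xt_in[of "t - 1"]] by (simp add: bregman_def)

text \<open>
  The error caused by using the old gradient is at most
  \<open>(norm A\<^sup>T\<Delta>y + norm \<Delta>f') * norm \<Delta>x\<close>. By the definition of the local estimates both factors
  are geometric means: \<open>norm A\<^sup>T\<Delta>y\<close> is \<open>LA\<close> times the dual movement, and \<open>(norm \<Delta>f')\<^sup>2\<close> is \<open>2 LF\<close>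
  times the Bregman distance. Young's inequality with weights \<open>\<tau> t\<close> and \<open>\<tau>t t\<close> therefore charges the
  error to quantities that the dual step and the convexity of \<open>f\<close> provide, and what is left in
  \<open>(norm \<Delta>x)\<^sup>2\<close> has a coefficient that the step-size rule bounds by one eighth.
\<close>

lemma gradient_change_absorbed:
  assumes t: "t \<ge> 2"
  shows "\<eta> (t + 1) * ((grad t - grad (t - 1)) \<bullet> (x t - x (t + 1)))
    \<le> \<eta> (t + 1) * (\<tau> t * (norm (y t - y (t - 1)))\<^sup>2 / 2 + \<tau>t t * bregman t)
      + (norm (x t - x (t + 1)))\<^sup>2 / 8"
proof -
  define w where "w = norm (x t - x (t + 1))"
  define dA where "dA = norm (transpose A *v (y t - y (t - 1)))"
  define df where "df = norm (f' (xt t) - f' (xt (t - 1)))"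
  obtain la where la: "LA A y t = ereal la" "0 \<le> la" "dA = la * norm (y t - y (t - 1))"
    unfolding dA_def by (rule LA_real)
  obtain lf where lf: "LF f f' xt t = ereal lf" "0 \<le> lf" "df\<^sup>2 = lf * (2 * bregman t)"
    unfolding df_def bregman_def
    by (rule LF_real[where xt = xt and t = t, OF f xt_in xt_in]) (use t in simp, assumption)
  have pt: "0 < \<eta> (t + 1)" "0 \<le> \<tau> t" "0 \<le> \<tau>t t"
    using pos t by auto
  have "ereal (\<eta> (t + 1)) \<le> inverse (4 * ereal (la\<^sup>2) / ereal (\<tau> t) + 4 * ereal lf / ereal (\<tau>t t))"
    using eta_bounds(4)[of "t + 1"] t la(1) lf(1) by simp
  note S = step_le_inverse_ratio_sum[OF pt(1) zero_le_power2 lf(2) pt(2,3) this]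
  have "dA * w \<le> \<tau> t * (norm (y t - y (t - 1)))\<^sup>2 / 2 + la\<^sup>2 / \<tau> t * w\<^sup>2 / 2"
    using S(1) pt la by (intro young_weighted) (auto simp: power_mult_distrib w_def)
  moreover have "df * w \<le> \<tau>t t * (2 * bregman t) / 2 + lf / \<tau>t t * w\<^sup>2 / 2"
    using S(2) pt lf bregman_nonneg by (intro young_weighted) (auto simp: w_def df_def)
  moreover have "(grad t - grad (t - 1)) \<bullet> (x t - x (t + 1)) \<le> dA * w + df * w"
  proof -
    have "grad t - grad (t - 1)
        = transpose A *v (y t - y (t - 1)) + (f' (xt t) - f' (xt (t - 1)))"
      by (simp add: grad_def matrix_vector_mult_diff_distrib)
    then have "(grad t - grad (t - 1)) \<bullet> (x t - x (t + 1))
        = (transpose A *v (y t - y (t - 1))) \<bullet> (x t - x (t + 1))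
          + (f' (xt t) - f' (xt (t - 1))) \<bullet> (x t - x (t + 1))"
      by (simp only: inner_add_left)
    then show ?thesis
      unfolding dA_def df_def w_def by (simp only: add_mono norm_cauchy_schwarz)
  qed
  ultimately have "(grad t - grad (t - 1)) \<bullet> (x t - x (t + 1))
      \<le> \<tau> t * (norm (y t - y (t - 1)))\<^sup>2 / 2 + \<tau>t t * bregman t
        + (la\<^sup>2 / \<tau> t + lf / \<tau>t t) * w\<^sup>2 / 2"
    by (simp add: algebra_simps add_divide_distrib)
  then have "\<eta> (t + 1) * ((grad t - grad (t - 1)) \<bullet> (x t - x (t + 1)))
      \<le> \<eta> (t + 1) * (\<tau> t * (norm (y t - y (t - 1)))\<^sup>2 / 2 + \<tau>t t * bregman t
        + (la\<^sup>2 / \<tau> t + lf / \<tau>t t) * w\<^sup>2 / 2)"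
    using pt by (intro mult_left_mono) auto
  also have "\<dots> = \<eta> (t + 1) * (\<tau> t * (norm (y t - y (t - 1)))\<^sup>2 / 2 + \<tau>t t * bregman t)
      + 4 * \<eta> (t + 1) * (la\<^sup>2 / \<tau> t + lf / \<tau>t t) * w\<^sup>2 / 8"
    by (simp add: algebra_simps)
  also have "4 * \<eta> (t + 1) * (la\<^sup>2 / \<tau> t + lf / \<tau>t t) * w\<^sup>2 \<le> 1 * w\<^sup>2"
    using S(3) by (intro mult_right_mono) auto
  finally show ?thesis
    by (simp add: w_def divide_right_mono)
qed

text \<open>
  A bound on the local Lipschitz quotient of the map from \<open>x\<close> to the gradient of the coupled objective, as seen in the
  first step: the dual response to a change of \<open>x\<close> passes through \<open>A\<close> twice and is divided by \<open>\<mu>\<close>.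
\<close>

abbreviation "L0 \<equiv> (real_of_ereal (LA A y 1))\<^sup>2 / \<mu> + real_of_ereal (LF f f' xt 1)"

lemma first_gradient_change:
  "norm (grad 1 - grad 0) \<le> L0 * norm (x 1 - x 0)" "0 \<le> L0" "4 * \<eta> 2 * L0 \<le> 1"
proof -
  obtain la where la: "LA A y 1 = ereal la" "0 \<le> la"
    "norm (transpose A *v (y 1 - y 0)) = la * norm (y 1 - y 0)"
    using LA_real[of A y 1] by auto
  obtain lf where lf: "LF f f' xt 1 = ereal lf" "0 \<le> lf"
    "norm (f' (xt 1) - f' (xt 0)) = lf * norm (xt 1 - xt 0)"
    by (rule LF_first_real)
  \<comment> \<open>The division by one gives the first-step rule the shape of the later ones, with \<open>\<mu>\<close> and \<open>1\<close> in
    the places of \<open>\<tau> t\<close> and \<open>\<tau>t t\<close>.\<close>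
  have L0: "L0 = la\<^sup>2 / \<mu> + lf / 1"
    using la lf by simp
  have "ereal (\<eta> 2) \<le> inverse (4 * ereal (la\<^sup>2) / ereal \<mu> + 4 * ereal lf / ereal 1)"
    using eta2 la(1) lf(1) by (simp add: one_ereal_def[symmetric])
  from step_le_inverse_ratio_sum(3)[OF _ zero_le_power2 lf(2) _ _ this] pos(1)[of 2] pos(4)
  show "4 * \<eta> 2 * L0 \<le> 1" unfolding L0 by simp
  show "0 \<le> L0" unfolding L0 using lf pos(4) by simp
  have "\<mu> * (norm (y 1 - y 0))\<^sup>2 \<le> (transpose A *v (y 1 - y 0)) \<bullet> (x 1 - x 0)"
    using dual_first_move by (simp only: adjoint)
  also have "\<dots> \<le> la * norm (y 1 - y 0) * norm (x 1 - x 0)"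
    unfolding la(3)[symmetric] by (rule norm_cauchy_schwarz)
  finally have "norm (y 1 - y 0) * (\<mu> * norm (y 1 - y 0))
      \<le> norm (y 1 - y 0) * (la * norm (x 1 - x 0))"
    by (simp add: power2_eq_square mult_ac)
  then have "\<mu> * norm (y 1 - y 0) \<le> la * norm (x 1 - x 0)"
    using la(2) by (cases "y 1 = y 0") auto
  then have "norm (y 1 - y 0) \<le> la / \<mu> * norm (x 1 - x 0)"
    using pos(4) by (simp add: field_simps)
  then have "la * norm (y 1 - y 0) \<le> la * (la / \<mu> * norm (x 1 - x 0))"
    using la(2) by (rule mult_left_mono)
  then have a: "norm (transpose A *v (y 1 - y 0)) \<le> la\<^sup>2 / \<mu> * norm (x 1 - x 0)"
    unfolding la(3) by (simp add: power2_eq_square)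
  have "grad 1 - grad 0 = transpose A *v (y 1 - y 0) + (f' (xt 1) - f' (xt 0))"
    by (simp add: grad_def matrix_vector_mult_diff_distrib)
  then have "norm (grad 1 - grad 0)
      \<le> norm (transpose A *v (y 1 - y 0)) + norm (f' (xt 1) - f' (xt 0))"
    by (simp only: norm_triangle_ineq)
  moreover have "norm (f' (xt 1) - f' (xt 0)) = lf * norm (x 1 - x 0)"
    using lf(3) by (simp only: first_iterates(1) starts(2))
  ultimately show "norm (grad 1 - grad 0) \<le> L0 * norm (x 1 - x 0)"
    using a unfolding L0 distrib_right div_by_1 by linarith
qed

section \<open>Summing the one-step estimates\<close>

text \<open>
  The contribution of step \<open>t\<close> to the gap, written before averaging. The terms in \<open>f\<close> and
  in the distance from \<open>y\<close> are left as differences between consecutive steps, since only their weighted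
  sum has coefficients of a fixed sign. Extrapolation from \<open>xt (t - 1)\<close> through \<open>xt t\<close> to \<open>x t\<close> is what
  produces the combination of the two values of \<open>f\<close>.
\<close>

definition step_gap :: "real^'n \<Rightarrow> real^'m \<Rightarrow> nat \<Rightarrow> real" where
  "step_gap u v t = ((1 + \<tau>t t) * f (xt t) - \<tau>t t * f (xt (t - 1))) - f u
     + (A *v x t) \<bullet> v - g v - (A *v u) \<bullet> y t + g (y t)
     + \<mu> / 2 * (norm (yt0 - y t))\<^sup>2 - \<mu> / 2 * (norm (yt0 - v))\<^sup>2
     + ((\<mu> + \<tau> t) * (norm (v - y t))\<^sup>2 - \<tau> t * (norm (v - y (t - 1)))\<^sup>2) / 2"

text \<open>
  The gradient at \<open>xt t\<close> is tested in the direction from \<open>u\<close> to \<open>x t\<close>. Writing \<open>x t\<close> as an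
  extrapolation splits this direction into one from \<open>u\<close>, where convexity of \<open>f\<close> applies, and one
  from \<open>xt (t - 1)\<close>, where the exact remainder is the Bregman distance. That remainder and the
  proximal term of the dual step are the two surpluses later used against the gradient error.
\<close>

lemma step_gap_le:
  assumes t: "t \<ge> 1" and u: "u \<in> X" and v: "v \<in> Y"
  shows "step_gap u v t \<le> grad t \<bullet> (x t - u)
    - (\<tau> t * (norm (y t - y (t - 1)))\<^sup>2 / 2 + \<tau>t t * bregman t)"
proof -
  have "f' (xt t) \<bullet> (x t - u) = f' (xt t) \<bullet> (xt t - u) + \<tau>t t * (f' (xt t) \<bullet> (xt t - xt (t - 1)))"
    by (subst x_from_xt[OF t]) (simp add: inner_diff_right algebra_simps)
  moreover have "f' (xt t) \<bullet> (xt t - u) \<ge> f (xt t) - f u"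
    using f_above_tangent[OF xt_in u, of t] by (simp add: inner_diff_right)
  moreover have "f' (xt t) \<bullet> (xt t - xt (t - 1)) = f (xt t) - f (xt (t - 1)) + bregman t"
    by (simp add: bregman_def inner_diff_right)
  then have "\<tau>t t * (f' (xt t) \<bullet> (xt t - xt (t - 1)))
      = \<tau>t t * f (xt t) - \<tau>t t * f (xt (t - 1)) + \<tau>t t * bregman t"
    by (simp only: distrib_left right_diff_distrib)
  ultimately have f_part: "(1 + \<tau>t t) * f (xt t) - \<tau>t t * f (xt (t - 1)) - f u + \<tau>t t * bregman t
      \<le> f' (xt t) \<bullet> (x t - u)"
    unfolding distrib_right mult_1 by linarith
  have "grad t \<bullet> (x t - u) = f' (xt t) \<bullet> (x t - u) + (A *v x t) \<bullet> y t - (A *v u) \<bullet> y t"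
    by (simp add: grad_def adjoint inner_diff_right inner_add_left)
  with f_part dual_opt[OF t v] show ?thesis
    by (simp add: step_gap_def inner_diff_right)
qed

lemma step_gap_first:
  assumes u: "u \<in> X" and v: "v \<in> Y"
  shows "\<eta> 2 * step_gap u v 1
    \<le> ((norm (x 0 - u))\<^sup>2 - (norm (xb 2 - u))\<^sup>2) / (2 * \<beta>) - (norm (x 2 - xb 1))\<^sup>2 / 4
      + (5 * \<eta> 2 * L0 / 4 - \<eta> 2 / (2 * \<eta> 1)) * (norm (x 1 - x 0))\<^sup>2"
proof -
  have "\<eta> 2 * step_gap u v 1 \<le> \<eta> 2 * (grad 1 \<bullet> (x 1 - u))"
    using step_gap_le[OF _ u v, of 1] pos(1)[of 2] unfolding init by simp
  also have "\<dots> \<le> ((norm (x 0 - u))\<^sup>2 - (norm (xb 2 - u))\<^sup>2) / (2 * \<beta>) - (norm (x 2 - x 0))\<^sup>2 / 4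
      + (5 * \<eta> 2 * L0 / 4 - \<eta> 2 / (2 * \<eta> 1)) * (norm (x 1 - x 0))\<^sup>2"
  proof (rule primal_step_first)
    show "\<eta> 2 * (grad 1 \<bullet> (x 2 - u)) \<le> (x 2 - x 0) \<bullet> (u - x 2)"
      using primal_opt[OF _ u, of 2] first_iterates by simp
    show "\<eta> 1 * (grad 0 \<bullet> (x 1 - x 2)) \<le> (x 1 - x 0) \<bullet> (x 2 - x 1)"
      using primal_opt[OF _ x_in, of 1 2] starts by simp
    show "xb 2 = (1 - \<beta>) *\<^sub>R x 0 + \<beta> *\<^sub>R x 2"
      using xb_step[of 2] first_iterates by simp
  qed (use pos eta2 first_gradient_change in auto)
  finally show ?thesis
    using first_iterates by simp
qed

text \<open>
  The surpluses in \<open>step_gap_le\<close> cancel the gradient error, and only telescoping terms remain.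
\<close>

lemma step_gap_later:
  assumes t: "t \<ge> 2" and u: "u \<in> X" and v: "v \<in> Y"
  shows "\<eta> (t + 1) * step_gap u v t
    \<le> ((norm (xb t - u))\<^sup>2 - (norm (xb (t + 1) - u))\<^sup>2) / (2 * \<beta>)
      + ((norm (x t - xb (t - 1)))\<^sup>2 - (norm (x (t + 1) - xb t))\<^sup>2) / 4"
proof -
  let ?E = "\<eta> (t + 1) * (\<tau> t * (norm (y t - y (t - 1)))\<^sup>2 / 2 + \<tau>t t * bregman t)"
  have "\<eta> (t + 1) * step_gap u v t \<le> \<eta> (t + 1) * (grad t \<bullet> (x t - u)
      - (\<tau> t * (norm (y t - y (t - 1)))\<^sup>2 / 2 + \<tau>t t * bregman t))"
    using step_gap_le[OF _ u v, of t] t pos(1)[of "t + 1"] by (intro mult_left_mono) auto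
  then have "\<eta> (t + 1) * step_gap u v t \<le> \<eta> (t + 1) * (grad t \<bullet> (x t - u)) - ?E"
    by (simp only: right_diff_distrib)
  moreover have "\<eta> (t + 1) * (grad t \<bullet> (x t - u))
      \<le> ((norm (xb t - u))\<^sup>2 - (norm (xb (t + 1) - u))\<^sup>2) / (2 * \<beta>)
      + ((norm (x t - xb (t - 1)))\<^sup>2 - (norm (x (t + 1) - xb t))\<^sup>2) / 4 + ?E"
  proof (rule primal_step_average[OF _ primal_opt])
    show "\<eta> (t + 1) * (grad t \<bullet> (x (t + 1) - u)) \<le> (x (t + 1) - xb t) \<bullet> (u - x (t + 1))"
      using primal_opt[OF _ u, of "t + 1"] by simp
    show "xb (t + 1) = (1 - \<beta>) *\<^sub>R xb t + \<beta> *\<^sub>R x (t + 1)"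
      using xb_step[of "t + 1"] t by simp
    show "\<eta> (t + 1) * ((grad t - grad (t - 1)) \<bullet> (x t - x (t + 1)))
        \<le> ?E + (norm (x t - x (t + 1)))\<^sup>2 / 8"
      by (rule gradient_change_absorbed[OF t])
  qed (use t pos eta_growth xb_step x_in in auto)
  ultimately show ?thesis by linarith
qed

lemma sum_step_gap_le:
  assumes k: "k \<ge> 1" and u: "u \<in> X" and v: "v \<in> Y"
  shows "(\<Sum>t=1..k. \<eta> (t + 1) * step_gap u v t)
    \<le> (norm (x 0 - u))\<^sup>2 / (2 * \<beta>)
      + (5 * \<eta> 2 * L0 / 4 - \<eta> 2 / (2 * \<eta> 1)) * (norm (x 1 - x 0))\<^sup>2
      - (norm (x (k + 1) - xb k))\<^sup>2 / 4 - (norm (xb (k + 1) - u))\<^sup>2 / (2 * \<beta>)"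
  using k
proof (induction k rule: dec_induct)
  case base
  show ?case
    using step_gap_first[OF u v] by (simp add: numeral_2_eq_2 diff_divide_distrib)
next
  case (step n)
  with step_gap_later[OF _ u v, of "Suc n"] show ?case
    by (simp add: diff_divide_distrib)
qed

text \<open>
  Every term of the gap is linear or convex in the averaged iterate, so Jensen's inequality
  applies. The value \<open>f xh\<close> needs care, since the steps supply values of \<open>f\<close> at \<open>xt t\<close> and
  not at \<open>x t\<close>. Collecting the differences gives a nonnegative combination of the \<open>f (xt t)\<close> whose
  barycentre is the same as that of the \<open>x t\<close>. The point \<open>ytilde\<close> is the barycentre that arises
  in the same way from the distances to \<open>v\<close>.
\<close>

lemma averaged_gap_le_sum:
  assumes k: "k \<ge> 1"
  defines "W \<equiv> (\<Sum>t=1..k. \<eta> (t + 1))"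
    and "xh \<equiv> weighted_avg \<eta> x k" and "yh \<equiv> weighted_avg \<eta> y k"
  shows "0 < W"
    and "W * (gap_Q A f g (xh, yh) (u, v) - \<mu> / 2 * (norm (yt0 - v))\<^sup>2
        + \<mu> / 2 * (norm (yt0 - yh))\<^sup>2 + \<mu> / 2 * (norm (ytilde \<mu> \<eta> \<tau> y k - v))\<^sup>2)
      \<le> (\<Sum>t=1..k. \<eta> (t + 1) * step_gap u v t)"
proof -
  let ?S = "\<lambda>h. \<Sum>t=1..k. \<eta> (t + 1) * h t"
  show W: "0 < W"
    unfolding W_def using k pos(1) by (intro sum_pos) auto
  have Wx: "W *\<^sub>R xh = (\<Sum>t=1..k. \<eta> (t + 1) *\<^sub>R x t)"
    and Wy: "W *\<^sub>R yh = (\<Sum>t=1..k. \<eta> (t + 1) *\<^sub>R y t)"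
    using W by (auto simp: xh_def yh_def weighted_avg_def W_def)
  have "(\<Sum>t=1..k. shifted_weight 1 \<eta> \<tau>t k t *\<^sub>R xt t) = (\<Sum>t=1..k. \<eta> (t + 1) *\<^sub>R x t)"
    unfolding sum_shifted_weight[where \<sigma> = \<tau>t, OF k init(2)]
    by (intro sum.cong refl) (simp add: x_from_xt)
  then have xh: "xh = (\<Sum>t=1..k. shifted_weight 1 \<eta> \<tau>t k t *\<^sub>R xt t) /\<^sub>R (1 * W)"
    by (simp add: xh_def weighted_avg_def W_def)
  have f_le: "W * f xh \<le> ?S (\<lambda>t. (1 + \<tau>t t) * f (xt t) - \<tau>t t * f (xt (t - 1)))"
    using jensen_shifted_weight[where \<eta> = \<eta> and \<sigma> = \<tau>t and u = xt and c = 1,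
        OF convex_f k init(2) _ xt_in pos(1,3) weights_nonneg(1)]
    unfolding xh W_def by simp
  have yt: "ytilde \<mu> \<eta> \<tau> y k = (\<Sum>t=1..k. shifted_weight \<mu> \<eta> \<tau> k t *\<^sub>R y t) /\<^sub>R (\<mu> * W)"
    by (simp only: ytilde_def W_def sum_shifted_weight_split[OF k])
  have yt_le: "\<mu> * W * (norm (v - ytilde \<mu> \<eta> \<tau> y k))\<^sup>2
      \<le> ?S (\<lambda>t. (\<mu> + \<tau> t) * (norm (v - y t))\<^sup>2 - \<tau> t * (norm (v - y (t - 1)))\<^sup>2)"
    unfolding yt W_def
    by (rule jensen_shifted_weight[OF convex_on_norm_diff_sq k init(1) pos(4) _ pos(1,2) weights_nonneg(2)])
      auto
  have yh_jensen: "W * h yh \<le> ?S (\<lambda>t. h (y t))" if "convex_on Y h" for h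
    unfolding yh_def weighted_avg_def W_def
    using jensen_weighted[OF that, of "\<lambda>t. \<eta> (t + 1)" "{1..k}" y] W y_in pos(1)
    by (auto simp: W_def less_imp_le)
  have g_le: "W * g yh \<le> ?S (\<lambda>t. g (y t))"
    by (rule yh_jensen[OF g])
  have n_le: "W * (norm (yt0 - yh))\<^sup>2 \<le> ?S (\<lambda>t. (norm (yt0 - y t))\<^sup>2)"
    by (rule yh_jensen, rule convex_on_subset[OF convex_on_norm_diff_sq])
      (use convex_on_imp_convex[OF g] in auto)
  have "W * ((A *v xh) \<bullet> v) = (W *\<^sub>R xh) \<bullet> (transpose A *v v)"
    unfolding adjoint by (simp add: inner_commute)
  then have Ax: "W * ((A *v xh) \<bullet> v) = ?S (\<lambda>t. (A *v x t) \<bullet> v)"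
    unfolding Wx adjoint by (simp add: inner_sum_right inner_commute)
  have "W * ((A *v u) \<bullet> yh) = (A *v u) \<bullet> (W *\<^sub>R yh)"
    by simp
  then have Ay: "W * ((A *v u) \<bullet> yh) = ?S (\<lambda>t. (A *v u) \<bullet> y t)"
    unfolding Wy by (simp add: inner_sum_right)
  have c: "?S (\<lambda>t. c) = W * c" for c
    by (simp add: W_def sum_distrib_right)
  have "?S (step_gap u v) = ?S (\<lambda>t. (1 + \<tau>t t) * f (xt t) - \<tau>t t * f (xt (t - 1))) - ?S (\<lambda>t. f u)
      + ?S (\<lambda>t. (A *v x t) \<bullet> v) - ?S (\<lambda>t. g v) - ?S (\<lambda>t. (A *v u) \<bullet> y t) + ?S (\<lambda>t. g (y t))
      + \<mu> / 2 * ?S (\<lambda>t. (norm (yt0 - y t))\<^sup>2) - ?S (\<lambda>t. \<mu> / 2 * (norm (yt0 - v))\<^sup>2)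
      + ?S (\<lambda>t. (\<mu> + \<tau> t) * (norm (v - y t))\<^sup>2 - \<tau> t * (norm (v - y (t - 1)))\<^sup>2) / 2"
    unfolding sum_distrib_left sum_divide_distrib sum.distrib[symmetric] sum_subtractf[symmetric]
    by (intro sum.cong refl) (simp add: step_gap_def field_simps)
  moreover have "\<mu> / 2 * (W * (norm (yt0 - yh))\<^sup>2) \<le> \<mu> / 2 * ?S (\<lambda>t. (norm (yt0 - y t))\<^sup>2)"
    using n_le pos(4) by (intro mult_left_mono) auto
  ultimately have "W * f xh - W * f u + W * ((A *v xh) \<bullet> v) - W * g v - W * ((A *v u) \<bullet> yh) + W * g yh
      + \<mu> / 2 * (W * (norm (yt0 - yh))\<^sup>2) - W * (\<mu> / 2 * (norm (yt0 - v))\<^sup>2)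
      + \<mu> * W * (norm (v - ytilde \<mu> \<eta> \<tau> y k))\<^sup>2 / 2 \<le> ?S (step_gap u v)"
    using f_le g_le yt_le unfolding c Ax Ay by linarith
  then show "W * (gap_Q A f g (xh, yh) (u, v) - \<mu> / 2 * (norm (yt0 - v))\<^sup>2
        + \<mu> / 2 * (norm (yt0 - yh))\<^sup>2 + \<mu> / 2 * (norm (ytilde \<mu> \<eta> \<tau> y k - v))\<^sup>2)
      \<le> ?S (step_gap u v)"
    by (simp add: gap_Q_def saddle_fun_def algebra_simps norm_minus_commute)
qed

end

theorem theorem4p2:
  fixes X :: "(real^'n) set" and Y :: "(real^'m) set"
    and A :: "real^'n^'m"
    and f :: "real^'n \<Rightarrow> real" and f' :: "real^'n \<Rightarrow> real^'n" and Lf :: real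
    and g :: "real^'m \<Rightarrow> real"
    and \<mu> \<beta> :: real and \<beta>s \<eta> \<tau> \<tau>t :: "nat \<Rightarrow> real"
    and yt0 :: "real^'m"
    and x xt xb :: "nat \<Rightarrow> real^'n" and y :: "nat \<Rightarrow> real^'m"
  assumes X: "X \<noteq> {}" "closed X" "convex X"
    and Y: "Y \<noteq> {}" "closed Y" "convex Y"
    and f: "smooth_convex_on X f f' Lf"
    and g: "convex_on Y g" "lsc_on Y g"
    and saddle: "\<exists>xs ys. saddle_point X Y (saddle_fun A f g) xs ys"
    and iter: "ac_apdhg X Y A f' g \<mu> \<beta>s \<eta> \<tau> \<tau>t yt0 x xt xb y"
    and pos: "\<And>t. t \<ge> 1 \<Longrightarrow> \<eta> t > 0" "\<And>t. t \<ge> 1 \<Longrightarrow> \<tau> t \<ge> 0" "\<And>t. t \<ge> 1 \<Longrightarrow> \<tau>t t \<ge> 0"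
      "\<mu> > 0" "0 < \<beta>" "\<beta> < 1"
    and init: "\<tau> 1 = 0" "\<tau>t 1 = 0" "\<beta>s 1 = 0" "\<And>t. t \<ge> 2 \<Longrightarrow> \<beta>s t = \<beta>"
    and eta2: "ereal (\<eta> 2) \<le>
      min (ereal ((1 - \<beta>) * \<eta> 1))
          (inverse (4 * (LA A y 1)\<^sup>2 / ereal \<mu> + 4 * LF f f' xt 1))"
    and eta: "\<And>t. t \<ge> 3 \<Longrightarrow> ereal (\<eta> t) \<le>
      Min {ereal (2 * (1 - \<beta>)\<^sup>2 * \<eta> (t - 1)),
           ereal (\<tau>t (t - 2) + 1) / ereal (\<tau>t (t - 1)) * ereal (\<eta> (t - 1)),
           ereal (\<tau> (t - 2) + \<mu>) / ereal (\<tau> (t - 1)) * ereal (\<eta> (t - 1)),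
           inverse (4 * (LA A y (t - 1))\<^sup>2 / ereal (\<tau> (t - 1))
                    + 4 * LF f f' xt (t - 1) / ereal (\<tau>t (t - 1)))}"
  shows "\<forall>z \<in> X \<times> Y. \<forall>k\<ge>2.
      gap_Q A f g (weighted_avg \<eta> x k, weighted_avg \<eta> y k) z
        - \<mu> / 2 * (norm (yt0 - snd z))\<^sup>2
        + \<mu> / 2 * (norm (yt0 - weighted_avg \<eta> y k))\<^sup>2
        + \<mu> / 2 * (norm (ytilde \<mu> \<eta> \<tau> y k - snd z))\<^sup>2
      \<le> 1 / (\<Sum>t=1..k. \<eta> (t + 1)) *
        ((norm (x 0 - fst z))\<^sup>2 / (2 * \<beta>)
         + (5 * \<eta> 2 * (real_of_ereal (LA A y 1))\<^sup>2 / (4 * \<mu>)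
            + 5 * \<eta> 2 * real_of_ereal (LF f f' xt 1) / 4
            - \<eta> 2 / (2 * \<eta> 1)) * (norm (x 1 - x 0))\<^sup>2
         - (norm (x (k + 1) - xb k))\<^sup>2 / 4
         - (norm (xb (k + 1) - fst z))\<^sup>2 / (2 * \<beta>))"
proof (intro ballI allI impI)
  fix z k assume z: "z \<in> X \<times> Y" and k: "2 \<le> (k::nat)"
  interpret ac_apdhg_run X Y A f f' Lf g \<mu> \<beta> \<beta>s \<eta> \<tau> \<tau>t yt0 x xt xb y
    by unfold_locales (fact f g(1) iter pos init eta2 eta)+
  obtain u v where uv: "z = (u, v)" "u \<in> X" "v \<in> Y"
    using z by auto
  have k1: "k \<ge> 1" using k by simp
  have "5 * \<eta> 2 * L0 / 4 - \<eta> 2 / (2 * \<eta> 1)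
      = 5 * \<eta> 2 * (real_of_ereal (LA A y 1))\<^sup>2 / (4 * \<mu>)
        + 5 * \<eta> 2 * real_of_ereal (LF f f' xt 1) / 4 - \<eta> 2 / (2 * \<eta> 1)"
    by (simp add: distrib_left add_divide_distrib mult.commute)
  from order_trans[OF averaged_gap_le_sum(2)[OF k1] sum_step_gap_le[OF k1 uv(2,3)], unfolded this]
    averaged_gap_le_sum(1)[OF k1]
  show "gap_Q A f g (weighted_avg \<eta> x k, weighted_avg \<eta> y k) z
        - \<mu> / 2 * (norm (yt0 - snd z))\<^sup>2
        + \<mu> / 2 * (norm (yt0 - weighted_avg \<eta> y k))\<^sup>2
        + \<mu> / 2 * (norm (ytilde \<mu> \<eta> \<tau> y k - snd z))\<^sup>2
      \<le> 1 / (\<Sum>t=1..k. \<eta> (t + 1)) *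
        ((norm (x 0 - fst z))\<^sup>2 / (2 * \<beta>)
         + (5 * \<eta> 2 * (real_of_ereal (LA A y 1))\<^sup>2 / (4 * \<mu>)
            + 5 * \<eta> 2 * real_of_ereal (LF f f' xt 1) / 4
            - \<eta> 2 / (2 * \<eta> 1)) * (norm (x 1 - x 0))\<^sup>2
         - (norm (x (k + 1) - xb k))\<^sup>2 / 4
         - (norm (xb (k + 1) - fst z))\<^sup>2 / (2 * \<beta>))"
    unfolding uv(1) fst_conv snd_conv times_divide_eq_left mult_1
    by (subst pos_le_divide_eq) (simp_all only: mult.commute)
qed

end
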